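(* Let $g:[0,1]\to\mathbb{R}^2$ be an open rectifiable plane arc (not necessarily simple) whose thickness $h$ is positive. Then there exist an angle $\theta$ and parameters $r<s<t$ in $[0,1]$ such that the point $g(s)$ lies on one of the two parallel support lines $l(\theta)$, $l(\theta+\pi)$ of $g$, while both points $g(r)$ and $g(t)$ lie on the other one of these two lines.
   Context: A rectifiable plane arc is a continuous map $g:[0,1]\to\mathbb{R}^2$ of finite length; it need not be injective. It is open if it is not closed, i.e. $g(0)\neq g(1)$. The thickness $h$ of $g$ is the minimum, over all directions, of the distance between the two parallel support lines of $g$ in that direction. For an angle $\theta$, $l(\theta)$ denotes the (counter-clockwise oriented) support line of $g$ in the direction of polar angle $\theta$: the line with direction vector $(\cos\theta,\sin\theta)$ that contains at least one point of $g([0,1])$ and is such that $g([0,1])$ lies in the closed half-plane to the left of the oriented line (for example, $g$ lies above $l(0)$). Thus $l(\theta)$ and $l(\theta+\pi)$ are the two parallel support lines of $g$ parallel to the direction $\theta$. *)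

theory Defs
  imports "HOL-Analysis.Analysis"
begin

definition polygon_length :: "(real \<Rightarrow> 'a::metric_space) \<Rightarrow> real list \<Rightarrow> real" where
  "polygon_length g ts = (\<Sum>i<length ts - 1. dist (g (ts ! i)) (g (ts ! Suc i)))"

definition arc_length :: "(real \<Rightarrow> 'a::metric_space) \<Rightarrow> ereal" where
  "arc_length g = (SUP ts \<in> {ts. sorted ts \<and> set ts \<subseteq> {0..1}}. ereal (polygon_length g ts))"

definition rectifiable_arc :: "(real \<Rightarrow> 'a::metric_space) \<Rightarrow> bool" where
  "rectifiable_arc g \<longleftrightarrow> continuous_on {0..1} g \<and> arc_length g < \<infinity>"

definition direction :: "real \<Rightarrow> real^2" where
  "direction \<theta> = vector [cos \<theta>, sin \<theta>]"

definition left_normal :: "real \<Rightarrow> real^2" where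
  "left_normal \<theta> = vector [- sin \<theta>, cos \<theta>]"

definition line_through :: "real^2 \<Rightarrow> real \<Rightarrow> (real^2) set" where
  "line_through p \<theta> = {p + c *\<^sub>R direction \<theta> | c. True}"

definition left_half_plane :: "real^2 \<Rightarrow> real \<Rightarrow> (real^2) set" where
  "left_half_plane p \<theta> = {q. 0 \<le> left_normal \<theta> \<bullet> (q - p)}"

definition is_support_line :: "(real \<Rightarrow> real^2) \<Rightarrow> real \<Rightarrow> (real^2) set \<Rightarrow> bool" where
  "is_support_line g \<theta> L \<longleftrightarrow>
    (\<exists>p \<in> g ` {0..1}. L = line_through p \<theta> \<and> g ` {0..1} \<subseteq> left_half_plane p \<theta>)"

(* Well-defined for continuous g, see ex1_support_line below. *)
definition support_line :: "(real \<Rightarrow> real^2) \<Rightarrow> real \<Rightarrow> (real^2) set" where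
  "support_line g \<theta> = (THE L. is_support_line g \<theta> L)"

definition width :: "(real \<Rightarrow> real^2) \<Rightarrow> real \<Rightarrow> real" where
  "width g \<theta> = setdist (support_line g \<theta>) (support_line g (\<theta> + pi))"

(* For continuous g the infimum is a minimum, see thickness_attained below. *)
definition thickness :: "(real \<Rightarrow> real^2) \<Rightarrow> real" where
  "thickness g = (INF \<theta>. width g \<theta>)"

lemma line_through_eq: "line_through p \<theta> = {q. left_normal \<theta> \<bullet> q = left_normal \<theta> \<bullet> p}"
proof (intro set_eqI iffI)
  fix q assume "q \<in> line_through p \<theta>"
  then show "q \<in> {q. left_normal \<theta> \<bullet> q = left_normal \<theta> \<bullet> p}"
    by (auto simp: line_through_def left_normal_def direction_def inner_vec_def sum_2 algebra_simps)
next
  fix q assume "q \<in> {q. left_normal \<theta> \<bullet> q = left_normal \<theta> \<bullet> p}"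
  then have eq: "cos \<theta> * (q$2 - p$2) = sin \<theta> * (q$1 - p$1)"
    by (simp add: left_normal_def inner_vec_def sum_2 algebra_simps)
  define c where "c = cos \<theta> * (q$1 - p$1) + sin \<theta> * (q$2 - p$2)"
  have sc: "sin \<theta> * sin \<theta> + cos \<theta> * cos \<theta> = 1"
    using sin_cos_squared_add[of \<theta>] by (simp add: power2_eq_square)
  have "c * cos \<theta> = (sin \<theta> * sin \<theta> + cos \<theta> * cos \<theta>) * (q$1 - p$1)"
    using eq unfolding c_def by algebra
  moreover have "c * sin \<theta> = (sin \<theta> * sin \<theta> + cos \<theta> * cos \<theta>) * (q$2 - p$2)"
    using eq unfolding c_def by algebra
  ultimately have "q = p + c *\<^sub>R direction \<theta>"
    by (simp add: sc vec_eq_iff forall_2 direction_def)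
  then show "q \<in> line_through p \<theta>" by (auto simp: line_through_def)
qed

lemma is_support_line_iff:
  "is_support_line g \<theta> L \<longleftrightarrow> (\<exists>p \<in> g ` {0..1}.
     L = {q. left_normal \<theta> \<bullet> q = left_normal \<theta> \<bullet> p} \<and>
     (\<forall>q \<in> g ` {0..1}. left_normal \<theta> \<bullet> p \<le> left_normal \<theta> \<bullet> q))"
  unfolding is_support_line_def line_through_eq left_half_plane_def
  by (simp add: inner_diff_right subset_iff Ball_def)

lemma ex1_support_line:
  assumes "continuous_on {0..1} g"
  shows "\<exists>!L. is_support_line g \<theta> L"
proof (rule ex_ex1I)
  have cont: "continuous_on {0..1} (\<lambda>t. left_normal \<theta> \<bullet> g t)"
    by (intro continuous_on_inner continuous_on_const assms)
  have "\<exists>t\<in>{0..1}. \<forall>u\<in>{0..1}. left_normal \<theta> \<bullet> g t \<le> left_normal \<theta> \<bullet> g u"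
    by (rule continuous_attains_inf[OF _ _ cont]) simp_all
  then show "\<exists>L. is_support_line g \<theta> L"
    unfolding is_support_line_iff by blast
next
  fix L M assume L: "is_support_line g \<theta> L" and M: "is_support_line g \<theta> M"
  let ?n = "left_normal \<theta>"
  obtain p where p: "p \<in> g ` {0..1}" "L = {x. ?n \<bullet> x = ?n \<bullet> p}"
    "\<And>x. x \<in> g ` {0..1} \<Longrightarrow> ?n \<bullet> p \<le> ?n \<bullet> x"
    using L unfolding is_support_line_iff by blast
  obtain q where q: "q \<in> g ` {0..1}" "M = {x. ?n \<bullet> x = ?n \<bullet> q}"
    "\<And>x. x \<in> g ` {0..1} \<Longrightarrow> ?n \<bullet> q \<le> ?n \<bullet> x"
    using M unfolding is_support_line_iff by blast
  have "?n \<bullet> p = ?n \<bullet> q"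
    using p(3)[OF q(1)] q(3)[OF p(1)] by (rule order_antisym)
  then show "L = M" by (simp only: p(2) q(2))
qed

lemma is_support_line_support_line:
  "continuous_on {0..1} g \<Longrightarrow> is_support_line g \<theta> (support_line g \<theta>)"
  unfolding support_line_def by (rule theI') (rule ex1_support_line)

lemma left_normal_add_pi: "left_normal (\<theta> + pi) = - left_normal \<theta>"
  by (simp add: left_normal_def vec_eq_iff forall_2)

lemma norm_left_normal: "norm (left_normal \<theta>) = 1"
  by (simp add: norm_vec_def L2_set_def sum_2 left_normal_def)

lemma setdist_parallel_lines:
  fixes n :: "'a::real_inner"
  assumes n: "norm n = 1" and ab: "a \<le> b" and ne: "n \<bullet> p = a" "n \<bullet> q = b"
  shows "setdist {x. n \<bullet> x = a} {x. n \<bullet> x = b} = b - a"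
proof (rule antisym)
  have nn: "n \<bullet> n = 1" using n by (simp add: norm_eq_1)
  have "setdist {x. n \<bullet> x = a} {x. n \<bullet> x = b} \<le> dist p (p + (b - a) *\<^sub>R n)"
    by (rule setdist_le_dist) (use ne nn in \<open>auto simp: inner_add_right\<close>)
  also have "\<dots> = b - a" using n ab by (simp add: dist_norm)
  finally show "setdist {x. n \<bullet> x = a} {x. n \<bullet> x = b} \<le> b - a" .
  show "b - a \<le> setdist {x. n \<bullet> x = a} {x. n \<bullet> x = b}"
  proof (rule le_setdistI)
    fix x y assume "x \<in> {x. n \<bullet> x = a}" "y \<in> {x. n \<bullet> x = b}"
    then have "b - a = n \<bullet> (y - x)" by (simp add: inner_diff_right)
    also have "\<dots> \<le> norm n * norm (y - x)" by (rule norm_cauchy_schwarz)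
    finally show "b - a \<le> dist x y" using n by (simp add: dist_norm norm_minus_commute)
  qed (use ne in auto)
qed

lemma width_extremal:
  assumes "continuous_on {0..1} g"
  obtains p q where "p \<in> g ` {0..1}" "q \<in> g ` {0..1}" "width g \<theta> = left_normal \<theta> \<bullet> (q - p)"
    "\<And>x y. x \<in> g ` {0..1} \<Longrightarrow> y \<in> g ` {0..1} \<Longrightarrow> left_normal \<theta> \<bullet> (y - x) \<le> width g \<theta>"
proof -
  let ?n = "left_normal \<theta>"
  obtain p where p: "p \<in> g ` {0..1}" "support_line g \<theta> = {x. ?n \<bullet> x = ?n \<bullet> p}"
    "\<And>x. x \<in> g ` {0..1} \<Longrightarrow> ?n \<bullet> p \<le> ?n \<bullet> x"
    using is_support_line_support_line[OF assms, of \<theta>] unfolding is_support_line_iff by blast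
  obtain q where q: "q \<in> g ` {0..1}" "support_line g (\<theta> + pi) = {x. ?n \<bullet> x = ?n \<bullet> q}"
    "\<And>x. x \<in> g ` {0..1} \<Longrightarrow> ?n \<bullet> x \<le> ?n \<bullet> q"
    using is_support_line_support_line[OF assms, of "\<theta> + pi"]
    unfolding is_support_line_iff left_normal_add_pi by (auto simp: inner_minus_left)
  have w: "width g \<theta> = ?n \<bullet> (q - p)"
    unfolding width_def p(2) q(2) inner_diff_right
    by (rule setdist_parallel_lines[OF norm_left_normal p(3)[OF q(1)]]) simp_all
  show thesis
  proof (rule that[OF p(1) q(1) w])
    fix x y assume "x \<in> g ` {0..1}" "y \<in> g ` {0..1}"
    then show "?n \<bullet> (y - x) \<le> width g \<theta>"
      using p(3)[of x] q(3)[of y] by (simp add: w inner_diff_right)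
  qed
qed

lemma continuous_on_left_normal: "continuous_on UNIV left_normal"
proof -
  have "left_normal = (\<lambda>\<theta>. \<chi> i. if i = 1 then - sin \<theta> else cos \<theta>)"
    by (auto simp: left_normal_def fun_eq_iff vec_eq_iff forall_2)
  moreover have "continuous_on UNIV (\<lambda>\<theta>. \<chi> i::2. if i = 1 then - sin \<theta> else cos (\<theta>::real))"
  proof (rule continuous_on_vec_lambda)
    fix i :: 2
    show "continuous_on UNIV (\<lambda>\<theta>::real. if i = 1 then - sin \<theta> else cos \<theta>)"
      by (cases "i = 1") (auto intro!: continuous_intros)
  qed
  ultimately show ?thesis by metis
qed

lemma continuous_on_width:
  assumes g: "continuous_on {0..1} g"
  shows "continuous_on UNIV (width g)"
proof -
  have "compact (g ` {0..1})" using g by (intro compact_continuous_image) auto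
  then obtain B where B: "B > 0" "\<And>x. x \<in> g ` {0..1} \<Longrightarrow> norm x \<le> B"
    using compact_imp_bounded bounded_pos by metis
  have le: "width g \<theta> \<le> width g \<phi> + 2 * B * dist (left_normal \<theta>) (left_normal \<phi>)" for \<theta> \<phi>
  proof -
    obtain p q where pq: "p \<in> g ` {0..1}" "q \<in> g ` {0..1}" "width g \<theta> = left_normal \<theta> \<bullet> (q - p)"
      by (rule width_extremal[OF g, of \<theta>])
    have le1: "left_normal \<phi> \<bullet> (q - p) \<le> width g \<phi>"
      by (rule width_extremal[OF g, of \<phi>]) (use pq in blast)
    have "left_normal \<theta> \<bullet> (q - p) - left_normal \<phi> \<bullet> (q - p)
        = (left_normal \<theta> - left_normal \<phi>) \<bullet> (q - p)"
      by (simp add: inner_diff_left)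
    also have "\<dots> \<le> norm (left_normal \<theta> - left_normal \<phi>) * norm (q - p)"
      by (rule norm_cauchy_schwarz)
    also have "\<dots> \<le> norm (left_normal \<theta> - left_normal \<phi>) * (2 * B)"
      using B(2)[OF pq(1)] B(2)[OF pq(2)] norm_triangle_ineq4[of q p]
      by (intro mult_left_mono) auto
    finally show ?thesis using le1 pq(3) by (simp add: dist_norm mult.commute)
  qed
  have lim: "((\<lambda>\<phi>. 2 * B * dist (left_normal \<phi>) (left_normal \<theta>)) \<longlongrightarrow> 0) (at \<theta>)" for \<theta>
  proof -
    have "(left_normal \<longlongrightarrow> left_normal \<theta>) (at \<theta>)"
      using continuous_on_left_normal by (simp add: continuous_on_def)
    then have "((\<lambda>\<phi>. dist (left_normal \<phi>) (left_normal \<theta>)) \<longlongrightarrow> 0) (at \<theta>)"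
      by (rule tendsto_dist_iff[THEN iffD1])
    then show ?thesis by (rule tendsto_mult_right_zero)
  qed
  show ?thesis
    unfolding continuous_on_def
  proof
    fix \<theta> :: real
    have "((\<lambda>\<phi>. width g \<phi> - width g \<theta>) \<longlongrightarrow> 0) (at \<theta>)"
    proof (rule Lim_null_comparison[OF _ lim])
      show "\<forall>\<^sub>F \<phi> in at \<theta>. norm (width g \<phi> - width g \<theta>)
          \<le> 2 * B * dist (left_normal \<phi>) (left_normal \<theta>)"
      proof (rule always_eventually, rule allI)
        fix \<phi>
        show "norm (width g \<phi> - width g \<theta>) \<le> 2 * B * dist (left_normal \<phi>) (left_normal \<theta>)"
          using le[of \<phi> \<theta>] le[of \<theta> \<phi>] by (simp add: dist_commute abs_le_iff)
      qed
    qed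
    then show "(width g \<longlongrightarrow> width g \<theta>) (at \<theta>)" by (simp add: LIM_zero_cancel)
  qed
qed

lemma support_line_periodic: "support_line g (\<theta> + 2 * pi * of_int k) = support_line g \<theta>"
proof -
  have "left_normal (\<theta> + 2 * pi * of_int k) = left_normal \<theta>"
    using sin_cos_eq_iff[of "\<theta> + 2 * pi * of_int k" \<theta>]
    by (auto simp: left_normal_def)
  then show ?thesis unfolding support_line_def is_support_line_iff by simp
qed

lemma thickness_attained:
  assumes "continuous_on {0..1} g"
  obtains \<theta> where "thickness g = width g \<theta>" "\<And>\<phi>. width g \<theta> \<le> width g \<phi>"
proof -
  have "continuous_on {0..2 * pi} (width g)"
    using continuous_on_width[OF assms] by (rule continuous_on_subset) simp
  then obtain \<theta> where th: "\<And>\<phi>. \<phi> \<in> {0..2 * pi} \<Longrightarrow> width g \<theta> \<le> width g \<phi>"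
    using continuous_attains_inf[of "{0..2 * pi}" "width g"] by fastforce
  have le: "width g \<theta> \<le> width g \<phi>" for \<phi>
  proof -
    define k where "k = \<lfloor>\<phi> / (2 * pi)\<rfloor>"
    define \<psi> where "\<psi> = \<phi> - 2 * pi * of_int k"
    have "of_int k \<le> \<phi> / (2 * pi)" "\<phi> / (2 * pi) \<le> of_int k + 1"
      unfolding k_def by linarith+
    then have "\<psi> \<in> {0..2 * pi}" unfolding \<psi>_def by (auto simp: field_simps)
    then have "width g \<theta> \<le> width g \<psi>" by (rule th)
    also have "width g \<psi> = width g \<phi>"
      using support_line_periodic[of g \<psi> k] support_line_periodic[of g "\<psi> + pi" k]
      by (simp add: width_def \<psi>_def algebra_simps)
    finally show ?thesis .
  qed
  moreover have "thickness g = width g \<theta>"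
    unfolding thickness_def by (rule cInf_eq_minimum) (use le in auto)
  ultimately show thesis using that by blast
qed

end

(* Say that theta is forward if some minimum parameter a and some maximum
   parameter b of the height above l(theta) satisfy a <= b. The forward angles form a closed
   set by compactness of [0,1], and every theta has theta or theta + pi forward. Since the
   line is connected, some theta has both: there are contact parameters a <= b and b' <= a'
   with a, a' on l(theta) and b, b' on l(theta + pi). As the two lines are disjoint, these
   inequalities are strict, and among the four parameters there is an alternating triple. *)

theory Submission
  imports Defs
begin

text \<open>Eliminates the definite description in \<open>support_line\<close>: contact becomes a
  family of weak inequalities indexed by \<open>u\<close>, the form in which closedness can be read
  off.\<close>

lemma mem_support_line_iff:
  assumes "continuous_on {0..1} g" "t \<in> {0..1}"
  shows "g t \<in> support_line g \<theta> \<longleftrightarrow>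
    (\<forall>u\<in>{0..1}. left_normal \<theta> \<bullet> g t \<le> left_normal \<theta> \<bullet> g u)"
proof -
  obtain p where p: "p \<in> g ` {0..1}"
    "support_line g \<theta> = {q. left_normal \<theta> \<bullet> q = left_normal \<theta> \<bullet> p}"
    "\<And>q. q \<in> g ` {0..1} \<Longrightarrow> left_normal \<theta> \<bullet> p \<le> left_normal \<theta> \<bullet> q"
    using is_support_line_support_line[OF assms(1), of \<theta>] unfolding is_support_line_iff by blast
  show ?thesis
    using p(1) p(3)[OF imageI[OF assms(2)]] p(3) unfolding p(2) by fastforce
qed

lemma mem_opposite_support_line_iff:
  assumes "continuous_on {0..1} g" "t \<in> {0..1}"
  shows "g t \<in> support_line g (\<theta> + pi) \<longleftrightarrow>
    (\<forall>u\<in>{0..1}. left_normal \<theta> \<bullet> g u \<le> left_normal \<theta> \<bullet> g t)"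
  by (simp add: mem_support_line_iff[OF assms] left_normal_add_pi)

text \<open>A common point would make the distance between the two lines zero, whereas every width
  is at least the thickness.\<close>

lemma support_lines_disjoint:
  assumes "continuous_on {0..1} g" "0 < thickness g"
  shows "support_line g \<theta> \<inter> support_line g (\<theta> + pi) = {}"
proof -
  have "0 < width g \<theta>"
    by (rule thickness_attained[OF assms(1)]) (use assms(2) less_le_trans in force)
  then show ?thesis
    unfolding width_def by (auto dest: setdist_eq_0I)
qed

text \<open>The order \<open>a \<le> b\<close> is weak so that the condition survives limits.
  Contact parameters need not be unique, so an angle and its opposite can both qualify.\<close>

definition forward_angles :: "(real \<Rightarrow> real^2) \<Rightarrow> real set" where
  "forward_angles g = {\<theta>. \<exists>a\<in>{0..1}. \<exists>b\<in>{0..1}. a \<le> b \<and>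
     g a \<in> support_line g \<theta> \<and> g b \<in> support_line g (\<theta> + pi)}"

lemma closed_forward_angles:
  assumes g: "continuous_on {0..1} g"
  shows "closed (forward_angles g)"
proof -
  let ?K = "{0..1::real} \<times> {0..1::real}"
  let ?D = "?K \<times> (UNIV :: real set)"
  let ?h = "\<lambda>\<theta> t. left_normal \<theta> \<bullet> g t"
  \<comment> \<open>Points of \<open>S\<close> are triples \<open>((a, b), \<theta>)\<close> in
    which \<open>a\<close> and \<open>b\<close> witness that \<open>\<theta>\<close> is forward. For
    each fixed \<open>u\<close> the constraints compare continuous functions of the triple, so
    \<open>S\<close> is an intersection of closed sets.\<close>
  define S where "S = {z \<in> ?D. fst (fst z) \<le> snd (fst z)} \<inter>
    (\<Inter>u\<in>{0..1}. {z \<in> ?D. ?h (snd z) (fst (fst z)) \<le> ?h (snd z) u} \<inter>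
                 {z \<in> ?D. ?h (snd z) u \<le> ?h (snd z) (snd (fst z))})"
  have D: "closed ?D"
    by (intro closed_Times) auto
  have n: "continuous_on ?D (\<lambda>z. left_normal (snd z))"
    by (rule continuous_on_compose2[OF continuous_on_left_normal]) (auto intro!: continuous_intros)
  have ga: "continuous_on ?D (\<lambda>z. g (fst (fst z)))"
    by (rule continuous_on_compose2[OF g]) (auto intro!: continuous_intros)
  have gb: "continuous_on ?D (\<lambda>z. g (snd (fst z)))"
    by (rule continuous_on_compose2[OF g]) (auto intro!: continuous_intros)
  have "closed S"
    unfolding S_def
    by (intro closed_Int closed_INT ballI continuous_on_closed_Collect_le[OF _ _ D]
        continuous_on_inner n ga gb continuous_on_const)
      (intro continuous_intros)+
  moreover have "compact ?K"
    by (intro compact_Times) auto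
  \<comment> \<open>Forgetting the witnesses is a projection along the compact square
    \<open>?K\<close>, which maps closed sets to closed sets.\<close>
  ultimately have "closed {\<theta>. \<exists>x. x \<in> ?K \<and> (x, \<theta>) \<in> S}"
    by (rule closed_compact_projection[rotated])
  moreover have "{\<theta>. \<exists>x. x \<in> ?K \<and> (x, \<theta>) \<in> S} = forward_angles g"
  proof -
    have "(\<exists>x. x \<in> ?K \<and> (x, \<theta>) \<in> S) \<longleftrightarrow> \<theta> \<in> forward_angles g" for \<theta>
    proof -
      have "((a, b), \<theta>) \<in> S \<longleftrightarrow>
          a \<le> b \<and> g a \<in> support_line g \<theta> \<and> g b \<in> support_line g (\<theta> + pi)"
        if "a \<in> {0..1}" "b \<in> {0..1}" for a b
        using that unfolding S_def mem_support_line_iff[OF g that(1)]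
          mem_opposite_support_line_iff[OF g that(2)] by auto
      then show ?thesis
        unfolding forward_angles_def by (simp add: Bex_def split_paired_Ex) blast
    qed
    then show ?thesis by blast
  qed
  ultimately show ?thesis by simp
qed

lemma support_line_add_2pi: "support_line g (\<theta> + pi + pi) = support_line g \<theta>"
  using support_line_periodic[of g \<theta> 1] by (simp add: algebra_simps)

text \<open>Choose any contact parameter on each line. Turning the angle by \<open>pi\<close> swaps
  the two lines, so whichever order the parameters have is the right one for one of the two
  angles.\<close>

lemma forward_or_opposite_forward:
  assumes "continuous_on {0..1} g"
  shows "\<theta> \<in> forward_angles g \<or> \<theta> + pi \<in> forward_angles g"
proof -
  have *: "\<exists>t\<in>{0..1}. g t \<in> support_line g \<phi>" for \<phi>
    using is_support_line_support_line[OF assms, of \<phi>] unfolding is_support_line_iff by auto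
  obtain a b where ab: "a \<in> {0..1}" "b \<in> {0..1}"
    "g a \<in> support_line g \<theta>" "g b \<in> support_line g (\<theta> + pi)"
    using *[of \<theta>] *[of "\<theta> + pi"] by blast
  show ?thesis
  proof (cases "a \<le> b")
    case True
    then have "\<theta> \<in> forward_angles g"
      unfolding forward_angles_def mem_Collect_eq
      using ab by (intro bexI[of _ a] bexI[of _ b] conjI)
    then show ?thesis ..
  next
    case False
    then have "b \<le> a" by simp
    then have "\<theta> + pi \<in> forward_angles g"
      unfolding forward_angles_def mem_Collect_eq support_line_add_2pi
      using ab by (intro bexI[of _ b] bexI[of _ a] conjI)
    then show ?thesis ..
  qed
qed

lemma ex_forward_and_opposite_forward:
  assumes g: "continuous_on {0..1} g"
  obtains \<theta> where "\<theta> \<in> forward_angles g" "\<theta> + pi \<in> forward_angles g"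
proof -
  let ?P = "forward_angles g" and ?N = "(\<lambda>\<theta>. \<theta> + pi) -` forward_angles g"
  have "closed ?N"
    using closed_forward_angles[OF g] by (intro closed_vimage) (auto intro!: continuous_intros)
  moreover have "?P \<union> ?N = UNIV"
    using forward_or_opposite_forward[OF g] by auto
  moreover have "?P \<noteq> {}"
    using forward_or_opposite_forward[OF g] by blast
  moreover have "?N \<noteq> {}"
  proof -
    obtain \<phi> where "\<phi> \<in> ?P" using \<open>?P \<noteq> {}\<close> by blast
    then have "\<phi> - pi \<in> ?N" by simp
    then show ?thesis by blast
  qed
  \<comment> \<open>Two nonempty closed sets that cover the connected real line must meet.\<close>
  ultimately have "?P \<inter> ?N \<noteq> {}"
    using connected_closedD[of UNIV ?P ?N] closed_forward_angles[OF g] by auto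
  then show thesis using that by blast
qed

theorem theorem1:
  fixes g :: "real \<Rightarrow> real^2"
  assumes "rectifiable_arc g"
    and "g 0 \<noteq> g 1"
    and "0 < thickness g"
  shows "\<exists>\<theta>. \<exists>r\<in>{0..1}. \<exists>s\<in>{0..1}. \<exists>t\<in>{0..1}. r < s \<and> s < t \<and>
    (g s \<in> support_line g \<theta> \<and> g r \<in> support_line g (\<theta> + pi) \<and> g t \<in> support_line g (\<theta> + pi) \<or>
     g s \<in> support_line g (\<theta> + pi) \<and> g r \<in> support_line g \<theta> \<and> g t \<in> support_line g \<theta>)"
proof -
  have g: "continuous_on {0..1} g"
    using assms(1) by (simp add: rectifiable_arc_def)
  obtain \<theta> where th: "\<theta> \<in> forward_angles g" "\<theta> + pi \<in> forward_angles g"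
    by (rule ex_forward_and_opposite_forward[OF g])
  obtain a b where ab: "a \<in> {0..1}" "b \<in> {0..1}" "a \<le> b"
    "g a \<in> support_line g \<theta>" "g b \<in> support_line g (\<theta> + pi)"
    using th(1) unfolding forward_angles_def mem_Collect_eq by (elim bexE conjE)
  obtain b' a' where ba: "b' \<in> {0..1}" "a' \<in> {0..1}" "b' \<le> a'"
    "g b' \<in> support_line g (\<theta> + pi)" "g a' \<in> support_line g \<theta>"
    using th(2) unfolding forward_angles_def mem_Collect_eq support_line_add_2pi
    by (elim bexE conjE)
  \<comment> \<open>Each pair lies on opposite lines. The order of \<open>a'\<close> and
    \<open>b\<close> then selects the alternating triple: \<open>a < b < a'\<close> or
    \<open>b' < a' < b\<close>.\<close>
  have "a \<noteq> b" "a' \<noteq> b" "b' \<noteq> a'"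
    using ab ba support_lines_disjoint[OF g assms(3), of \<theta>] by auto
  with ab ba have "a < b" "b' < a'" "b < a' \<or> a' < b"
    by auto
  then show ?thesis
  proof (elim disjE)
    assume "b < a'"
    then show ?thesis
      using ab ba \<open>a < b\<close> by (intro exI[of _ \<theta>] bexI[of _ a] bexI[of _ b] bexI[of _ a']) simp_all
  next
    assume "a' < b"
    then show ?thesis
      using ab ba \<open>b' < a'\<close> by (intro exI[of _ \<theta>] bexI[of _ b'] bexI[of _ a'] bexI[of _ b]) simp_all
  qed
qed

end
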